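(* Let $k \geq 2$ be an integer and let $G$ be a graph on $n \geq 2^{2k}$ vertices. Then $G$ contains no odd $k$-vertex subgraph if and only if at least one of the following conditions holds: 1. $G$ is an independent set; 2. $k$ is odd and $G$ is a complete bipartite graph; 3. $\binom{k}{2}$ is even and $G$ is a clique; 4. $k \equiv 1 \pmod 4$ and $G$ is the disjoint union of two cliques.
   Context: All graphs are finite and simple. An odd $k$-vertex subgraph of $G$ is an induced subgraph $G[U]$, with $U\subseteq V(G)$ and $|U|=k$, having an odd number of edges. "$G$ is an independent set" means $G$ has no edges; "$G$ is a clique" means $G$ is a complete graph. "$G$ is the disjoint union of two cliques" means $V(G)$ can be partitioned into two sets, each inducing a complete graph, with no edges of $G$ between them. *)

theory Defs
  imports Complex_Main "HOL-Library.Ramsey"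
begin

text \<open>A graph is a vertex set \<open>V\<close> together with a set \<open>E\<close> of two-element subsets of \<open>V\<close>.\<close>

definition simple_graph :: "'a set \<Rightarrow> 'a set set \<Rightarrow> bool" where
  "simple_graph V E \<longleftrightarrow> finite V \<and> E \<subseteq> nsets V 2"

definition induced_edges :: "'a set set \<Rightarrow> 'a set \<Rightarrow> 'a set set" where
  "induced_edges E U = {e \<in> E. e \<subseteq> U}"

definition has_odd_subgraph :: "nat \<Rightarrow> 'a set \<Rightarrow> 'a set set \<Rightarrow> bool" where
  "has_odd_subgraph k V E \<longleftrightarrow>
     (\<exists>U \<subseteq> V. card U = k \<and> odd (card (induced_edges E U)))"

text \<open>Both parts are nonempty; the empty-part cases of the two notions below are an edgeless graph
  and a complete graph, respectively.\<close>

definition bipartition :: "'a set \<Rightarrow> 'a set \<Rightarrow> 'a set \<Rightarrow> bool" where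
  "bipartition V A B \<longleftrightarrow> A \<noteq> {} \<and> B \<noteq> {} \<and> A \<union> B = V \<and> A \<inter> B = {}"

definition complete_bipartite :: "'a set \<Rightarrow> 'a set set \<Rightarrow> bool" where
  "complete_bipartite V E \<longleftrightarrow>
     (\<exists>A B. bipartition V A B \<and> E = {{a, b} | a b. a \<in> A \<and> b \<in> B})"

definition disjoint_union_two_cliques :: "'a set \<Rightarrow> 'a set set \<Rightarrow> bool" where
  "disjoint_union_two_cliques V E \<longleftrightarrow>
     (\<exists>A B. bipartition V A B \<and> clique A E \<and> clique B E \<and>
        (\<forall>a\<in>A. \<forall>b\<in>B. {a, b} \<notin> E))"

end

theory Submission
  imports Defs
begin

text \<open>
  The argument is a second-difference argument modulo 2. Let \<open>a, b, c, d\<close> be distinct vertices and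
  \<open>W\<close> a set of \<open>k - 2\<close> further vertices. If the edge counts of the four graphs induced on
  \<open>W \<union> {a, c}\<close>, \<open>W \<union> {a, d}\<close>, \<open>W \<union> {b, c}\<close>, \<open>W \<union> {b, d}\<close> are added, everything but the
  pairs \<open>ac, ad, bc, bd\<close> is counted an even number of times. So, if no \<open>k\<close> vertices induce an odd
  number of edges, every 4-cycle \<open>a c b d\<close> of the complete graph on \<open>V\<close> carries an even number of
  edges of \<open>G\<close> (\<open>even_four_cycle\<close>).

  Two triangles that share an edge differ by such a 4-cycle, so all triangles through a fixed
  vertex \<open>z\<close> contain the same number of edges modulo 2. Hence adjacency of two vertices is
  determined by their adjacencies to \<open>z\<close>: there are a two-colouring \<open>P\<close> and a bit \<open>s\<close> such that
  distinct \<open>u, v\<close> are adjacent if and only if \<open>(P u \<noteq> P v) \<noteq> s\<close>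
  (\<open>two_coloured_if_no_odd_subgraph\<close>). With two nonempty colour classes this is a complete bipartite
  graph (\<open>s\<close> false) or a disjoint union of two cliques (\<open>s\<close> true); with a single colour class it
  is an edgeless graph or a clique.

  In such a graph a set with \<open>a\<close> vertices of one colour and \<open>b\<close> of the other spans, modulo 2,
  \<open>a b\<close> edges, plus \<open>(a + b) choose 2\<close> if \<open>s\<close> is true. Testing this on \<open>k\<close>-sets with at most
  one vertex from the smaller class shows which \<open>k\<close> occur (\<open>no_odd_subgraph_iff_two_coloured\<close>).
  Choosing \<open>W\<close> takes \<open>k + 2\<close> vertices, and a colour class of size \<open>k\<close> is guaranteed by \<open>2 * k\<close>
  vertices.
\<close>

section \<open>Counting induced edges\<close>

definition nbr_count :: "'a set set \<Rightarrow> 'a \<Rightarrow> 'a set \<Rightarrow> nat" where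
  "nbr_count E v U = card {u \<in> U. {v, u} \<in> E}"

lemma nbr_count_insert:
  assumes "finite U" "u \<notin> U"
  shows "nbr_count E v (insert u U) = nbr_count E v U + of_bool ({v, u} \<in> E)"
proof (cases "{v, u} \<in> E")
  case True
  then have "{w \<in> insert u U. {v, w} \<in> E} = insert u {w \<in> U. {v, w} \<in> E}" by auto
  then show ?thesis using assms True by (simp add: nbr_count_def)
next
  case False
  then have "{w \<in> insert u U. {v, w} \<in> E} = {w \<in> U. {v, w} \<in> E}" by auto
  then show ?thesis using False by (simp add: nbr_count_def)
qed

lemma edgeE:
  assumes "simple_graph V E" "e \<in> E"
  obtains u v where "e = {u, v}" "u \<in> V" "v \<in> V" "u \<noteq> v"
  using assms by (auto simp: simple_graph_def nsets_def card_2_iff)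

lemma card_induced_edges_insert:
  assumes G: "simple_graph V E" and "finite U" "v \<notin> U"
  shows "card (induced_edges E (insert v U)) = card (induced_edges E U) + nbr_count E v U"
proof -
  let ?N = "{u \<in> U. {v, u} \<in> E}"
  have "induced_edges E (insert v U) \<subseteq> induced_edges E U \<union> (\<lambda>u. {v, u}) ` ?N"
  proof
    fix e assume e: "e \<in> induced_edges E (insert v U)"
    then have "e \<in> E" by (simp add: induced_edges_def)
    then obtain x y where "e = {x, y}" "x \<noteq> y" using G by (meson edgeE)
    then show "e \<in> induced_edges E U \<union> (\<lambda>u. {v, u}) ` ?N"
      using e by (auto simp: induced_edges_def insert_commute)
  qed
  then have split: "induced_edges E (insert v U) = induced_edges E U \<union> (\<lambda>u. {v, u}) ` ?N"
    by (auto simp: induced_edges_def)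
  have "finite (induced_edges E U)"
    by (rule finite_subset[of _ "Pow U"]) (use assms in \<open>auto simp: induced_edges_def\<close>)
  moreover have "induced_edges E U \<inter> (\<lambda>u. {v, u}) ` ?N = {}"
    using assms(3) by (auto simp: induced_edges_def)
  moreover have "inj_on (\<lambda>u. {v, u}) ?N"
    by (auto simp: inj_on_def doubleton_eq_iff)
  ultimately show ?thesis
    using assms(2) by (simp add: split card_Un_disjoint card_image nbr_count_def)
qed

lemma card_induced_edges_insert2:
  assumes "simple_graph V E" "finite W" "u \<notin> W" "v \<notin> W" "u \<noteq> v"
  shows "card (induced_edges E (insert u (insert v W))) =
    card (induced_edges E W) + nbr_count E u W + nbr_count E v W + of_bool ({u, v} \<in> E)"
  using assms by (simp add: card_induced_edges_insert[of V] nbr_count_insert)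

section \<open>Two-coloured graphs\<close>

text \<open>
  Modulo 2, the condition says that the adjacency matrix is \<open>P u + P v + s\<close> off the diagonal. It
  treats the four types of graphs in the classification uniformly.
\<close>

definition two_coloured :: "'a set \<Rightarrow> 'a set set \<Rightarrow> ('a \<Rightarrow> bool) \<Rightarrow> bool \<Rightarrow> bool" where
  "two_coloured V E P s \<longleftrightarrow>
     (\<forall>u\<in>V. \<forall>v\<in>V. u \<noteq> v \<longrightarrow> ({u, v} \<in> E \<longleftrightarrow> (P u \<noteq> P v) \<noteq> s))"

lemma edgeless_if_two_coloured:
  assumes "simple_graph V E" "two_coloured V E P False" "{v \<in> V. P v} = {} \<or> {v \<in> V. \<not> P v} = {}"
  shows "E = {}"
proof (rule ccontr)
  assume "E \<noteq> {}"
  then obtain u v where "{u, v} \<in> E" "u \<in> V" "v \<in> V" "u \<noteq> v"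
    using assms(1) by (metis edgeE ex_in_conv)
  then show False using assms(2,3) by (auto simp: two_coloured_def)
qed

lemma clique_if_two_coloured:
  assumes "two_coloured V E P True" "{v \<in> V. P v} = {} \<or> {v \<in> V. \<not> P v} = {}"
  shows "clique V E"
  using assms by (auto simp: two_coloured_def clique_def)

lemma complete_bipartite_if_two_coloured:
  assumes G: "simple_graph V E" and col: "two_coloured V E P False"
    and ne: "{v \<in> V. P v} \<noteq> {}" "{v \<in> V. \<not> P v} \<noteq> {}"
  shows "complete_bipartite V E"
proof -
  let ?A = "{v \<in> V. P v}" and ?B = "{v \<in> V. \<not> P v}"
  have "E \<subseteq> {{a, b} | a b. a \<in> ?A \<and> b \<in> ?B}"
  proof
    fix e assume "e \<in> E"
    then obtain u v where e: "e = {u, v}" and uv: "u \<in> V" "v \<in> V" "u \<noteq> v"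
      using G by (rule_tac edgeE)
    then have "P u \<noteq> P v" using col \<open>e \<in> E\<close> by (auto simp: two_coloured_def)
    then show "e \<in> {{a, b} | a b. a \<in> ?A \<and> b \<in> ?B}"
      using e uv by (cases "P u") (auto simp: insert_commute)
  qed
  moreover have "{{a, b} | a b. a \<in> ?A \<and> b \<in> ?B} \<subseteq> E"
    using col by (auto simp: two_coloured_def)
  ultimately have "E = {{a, b} | a b. a \<in> ?A \<and> b \<in> ?B}" by blast
  moreover have "bipartition V ?A ?B" using ne by (auto simp: bipartition_def)
  ultimately show ?thesis unfolding complete_bipartite_def by blast
qed

lemma disjoint_union_two_cliques_if_two_coloured:
  assumes col: "two_coloured V E P True"
    and ne: "{v \<in> V. P v} \<noteq> {}" "{v \<in> V. \<not> P v} \<noteq> {}"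
  shows "disjoint_union_two_cliques V E"
proof -
  let ?A = "{v \<in> V. P v}" and ?B = "{v \<in> V. \<not> P v}"
  have "bipartition V ?A ?B" using ne by (auto simp: bipartition_def)
  moreover have "clique ?A E" "clique ?B E" "\<forall>a\<in>?A. \<forall>b\<in>?B. {a, b} \<notin> E"
    using col by (auto simp: two_coloured_def clique_def)
  ultimately show ?thesis unfolding disjoint_union_two_cliques_def by blast
qed

lemma two_coloured_if_complete_bipartite:
  assumes "complete_bipartite V E"
  shows "\<exists>P. two_coloured V E P False"
proof -
  obtain A B where AB: "bipartition V A B" "E = {{a, b} | a b. a \<in> A \<and> b \<in> B}"
    using assms by (auto simp: complete_bipartite_def)
  then have "two_coloured V E (\<lambda>v. v \<in> A) False"
    by (auto simp: two_coloured_def bipartition_def doubleton_eq_iff)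
  then show ?thesis by blast
qed

lemma two_coloured_if_disjoint_union_two_cliques:
  assumes "disjoint_union_two_cliques V E"
  shows "\<exists>P. two_coloured V E P True"
proof -
  obtain A B where AB: "bipartition V A B" "clique A E" "clique B E" "\<forall>a\<in>A. \<forall>b\<in>B. {a, b} \<notin> E"
    using assms by (auto simp: disjoint_union_two_cliques_def)
  have "{v, u} \<notin> E" if "u \<in> B" "v \<in> A" for u v using AB(4) that by simp
  moreover have "{u, v} \<notin> E" if "u \<in> B" "v \<in> A" for u v
    using AB(4) that by (subst insert_commute) simp
  ultimately have "two_coloured V E (\<lambda>v. v \<in> A) True"
    using AB by (auto simp: two_coloured_def bipartition_def clique_def)
  then show ?thesis by blast
qed

lemma choose_two_Suc: "Suc n choose 2 = (n choose 2) + n"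
  by (simp add: numeral_2_eq_2)

text \<open>
  With \<open>a\<close> and \<open>b\<close> vertices in the two classes, the exact number of edges is \<open>a b\<close> for false \<open>s\<close>
  and \<open>((a + b) choose 2) - a b\<close> for true \<open>s\<close>; one sum modulo 2 covers both cases.
  A new vertex is joined to the whole opposite class if \<open>s\<close> is false and to the whole of its own
  class if \<open>s\<close> is true, which gives the induction.
\<close>

lemma even_card_induced_edges_two_coloured:
  assumes G: "simple_graph V E" and "two_coloured V E P s" "finite U" "U \<subseteq> V"
  shows "even (card (induced_edges E U) + card {u \<in> U. P u} * card {u \<in> U. \<not> P u}
      + of_bool s * (card U choose 2))"
  using assms(3,4)
proof (induction U rule: finite_induct)
  case empty
  have "induced_edges E {} = {}"
    using G by (auto simp: induced_edges_def elim!: edgeE)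
  then show ?case by (simp add: numeral_2_eq_2)
next
  case (insert v U)
  let ?a = "card {u \<in> U. P u}" and ?b = "card {u \<in> U. \<not> P u}"
  have U: "card U = ?a + ?b"
    using insert.hyps(1) by (subst card_Un_disjoint[symmetric]) (auto intro: arg_cong[where f = card])
  have nbr: "nbr_count E v U = card {u \<in> U. (P v \<noteq> P u) \<noteq> s}"
  proof -
    have "{v, u} \<in> E \<longleftrightarrow> (P v \<noteq> P u) \<noteq> s" if "u \<in> U" for u
    proof -
      have "v \<in> V" "u \<in> V" "v \<noteq> u" using that insert.hyps insert.prems by auto
      then show ?thesis using assms(2) unfolding two_coloured_def by blast
    qed
    then show ?thesis unfolding nbr_count_def by (intro arg_cong[where f = card]) blast
  qed
  have ih: "even (card (induced_edges E U) + ?a * ?b + of_bool s * (card U choose 2))"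
    using insert by simp
  have cnt: "card (induced_edges E (insert v U)) = card (induced_edges E U) + nbr_count E v U"
    using G insert.hyps by (rule card_induced_edges_insert)
  have ch: "card (insert v U) choose 2 = (card U choose 2) + (?a + ?b)"
    using insert.hyps U by (simp add: choose_two_Suc)
  show ?case
  proof (cases "P v")
    case True
    then have "{u \<in> insert v U. P u} = insert v {u \<in> U. P u}"
      "{u \<in> insert v U. \<not> P u} = {u \<in> U. \<not> P u}" by auto
    then have "card {u \<in> insert v U. P u} = ?a + 1" "card {u \<in> insert v U. \<not> P u} = ?b"
      using insert.hyps by simp_all
    moreover have "nbr_count E v U = (if s then ?a else ?b)" using nbr True by simp
    ultimately show ?thesis
      using ih by (cases s) (simp_all only: cnt ch even_add even_mult_iff of_bool_eq if_True
        if_False odd_one dvd_0_right simp_thms, argo+)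
  next
    case False
    then have "{u \<in> insert v U. P u} = {u \<in> U. P u}"
      "{u \<in> insert v U. \<not> P u} = insert v {u \<in> U. \<not> P u}" by auto
    then have "card {u \<in> insert v U. P u} = ?a" "card {u \<in> insert v U. \<not> P u} = ?b + 1"
      using insert.hyps by simp_all
    moreover have "nbr_count E v U = (if s then ?b else ?a)" using nbr False by simp
    ultimately show ?thesis
      using ih by (cases s) (simp_all only: cnt ch even_add even_mult_iff of_bool_eq if_True
        if_False odd_one dvd_0_right simp_thms, argo+)
  qed
qed

lemma two_coloured_swap: "two_coloured V E (\<lambda>v. \<not> P v) s \<longleftrightarrow> two_coloured V E P s"
  by (auto simp: two_coloured_def)

text \<open>
  Necessity uses a \<open>k\<close>-set inside the class with at least \<open>k\<close> vertices, which spans 0 or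
  \<open>k choose 2\<close> edges, and the effect of exchanging one of its vertices for one of the other class,
  which changes the parity by that of \<open>k - 1\<close>.
\<close>

lemma no_odd_subgraph_necessary:
  assumes G: "simple_graph V E" and col: "two_coloured V E P s" and "k \<ge> 1"
    and large: "k \<le> card {v \<in> V. P v}" and no: "\<not> has_odd_subgraph k V E"
  shows "(s \<longrightarrow> even (k choose 2)) \<and> ({v \<in> V. \<not> P v} \<noteq> {} \<longrightarrow> odd k)"
proof -
  have fin: "finite V" using G by (simp add: simple_graph_def)
  have ev: "even (card {u \<in> U. P u} * card {u \<in> U. \<not> P u} + of_bool s * (k choose 2))"
    if "U \<subseteq> V" "card U = k" for U
    using even_card_induced_edges_two_coloured[OF G col finite_subset[OF that(1) fin] that(1)]
      no that by (auto simp: has_odd_subgraph_def)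
  obtain U where U: "U \<subseteq> {v \<in> V. P v}" "card U = k"
    using large by (meson obtain_subset_with_card_n)
  then have none: "{u \<in> U. \<not> P u} = {}" and "U \<subseteq> V" by auto
  have s: "even (of_bool s * (k choose 2) :: nat)"
    using ev[OF \<open>U \<subseteq> V\<close> U(2)] unfolding none by simp
  moreover have "odd k" if "b \<in> V" "\<not> P b" for b
  proof -
    have "k - 1 \<le> card {v \<in> V. P v}" using large by simp
    then obtain U' where U': "U' \<subseteq> {v \<in> V. P v}" "card U' = k - 1" "finite U'"
      by (meson obtain_subset_with_card_n)
    then have "{u \<in> insert b U'. P u} = U'" "{u \<in> insert b U'. \<not> P u} = {b}" "b \<notin> U'"
      using that by auto
    moreover have "insert b U' \<subseteq> V" using U'(1) that by auto
    moreover have "card (insert b U') = k" using U' \<open>b \<notin> U'\<close> \<open>k \<ge> 1\<close> by simp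
    ultimately have "even ((k - 1) * 1 + of_bool s * (k choose 2))"
      using ev[of "insert b U'"] U'(2) by simp
    then have "even (k - 1)" using s by (simp only: even_add mult_1_right simp_thms)
    then show ?thesis using \<open>k \<ge> 1\<close> by simp
  qed
  ultimately show ?thesis by auto
qed

lemma no_odd_subgraph_iff_two_coloured:
  assumes G: "simple_graph V E" and col: "two_coloured V E P s" and "k \<ge> 1" "card V \<ge> 2 * k"
  shows "\<not> has_odd_subgraph k V E \<longleftrightarrow>
    (s \<longrightarrow> even (k choose 2)) \<and> ({v \<in> V. P v} \<noteq> {} \<and> {v \<in> V. \<not> P v} \<noteq> {} \<longrightarrow> odd k)"
    (is "_ \<longleftrightarrow> ?R")
proof
  have fin: "finite V" using G by (simp add: simple_graph_def)
  have split: "card U = card {v \<in> U. P v} + card {v \<in> U. \<not> P v}" if "finite U" for U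
    using that by (subst card_Un_disjoint[symmetric]) (auto intro: arg_cong[where f = card])
  {
    assume no: "\<not> has_odd_subgraph k V E"
    consider "k \<le> card {v \<in> V. P v}" | "k \<le> card {v \<in> V. \<not> P v}"
      using split[OF fin] assms(4) by linarith
    then show ?R
    proof cases
      case 1
      then show ?thesis using no_odd_subgraph_necessary[OF G col \<open>k \<ge> 1\<close> _ no] by blast
    next
      case 2
      then show ?thesis
        using no_odd_subgraph_necessary[OF G two_coloured_swap[THEN iffD2, OF col] \<open>k \<ge> 1\<close> _ no]
        by auto
    qed
  next
    assume R: ?R
    have "even (card (induced_edges E U))" if U: "U \<subseteq> V" "card U = k" for U
    proof -
      let ?a = "card {u \<in> U. P u}" and ?b = "card {u \<in> U. \<not> P u}"
      have "finite U" using U fin by (meson finite_subset)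
      then have "k = ?a + ?b" using split U by blast
      moreover have "?a = 0 \<or> ?b = 0 \<or> odd k"
      proof (cases "odd k")
        case False
        then have "{u \<in> U. P u} = {} \<or> {u \<in> U. \<not> P u} = {}" using R U(1) by blast
        then show ?thesis by (metis card.empty)
      qed simp
      ultimately have "even (?a * ?b)" by auto
      then show ?thesis
        using even_card_induced_edges_two_coloured[OF G col \<open>finite U\<close> U(1)] R U(2)
        by (cases s) auto
    qed
    then show "\<not> has_odd_subgraph k V E" by (auto simp: has_odd_subgraph_def)
  }
qed

section \<open>Graphs without odd subgraphs are two-coloured\<close>

lemma even_four_cycle:
  assumes G: "simple_graph V E" and "k \<ge> 2" "card V \<ge> k + 2"
    and no: "\<not> has_odd_subgraph k V E"
    and V: "a \<in> V" "b \<in> V" "c \<in> V" "d \<in> V" and dist: "distinct [a, b, c, d]"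
  shows "({a, c} \<in> E \<longleftrightarrow> {b, c} \<in> E) \<longleftrightarrow> ({a, d} \<in> E \<longleftrightarrow> {b, d} \<in> E)"
proof -
  have "finite V" using G by (simp add: simple_graph_def)
  then have "card (V - {a, b, c, d}) = card V - 4"
    using V dist by (simp add: card_Diff_subset)
  then have "k - 2 \<le> card (V - {a, b, c, d})" using assms(2,3) by simp
  then obtain W where W: "W \<subseteq> V - {a, b, c, d}" "card W = k - 2" "finite W"
    by (meson obtain_subset_with_card_n)
  have par: "{u, v} \<in> E \<longleftrightarrow> odd (card (induced_edges E W) + nbr_count E u W + nbr_count E v W)"
    if "u \<in> {a, b}" "v \<in> {c, d}" for u v
  proof -
    have uv: "u \<in> V" "v \<in> V" "u \<notin> W" "v \<notin> W" "u \<noteq> v" using that W(1) V dist by auto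
    then have "card (insert u (insert v W)) = k" using W \<open>k \<ge> 2\<close> by simp
    moreover have "insert u (insert v W) \<subseteq> V" using uv W(1) by auto
    ultimately have "even (card (induced_edges E (insert u (insert v W))))"
      using no by (auto simp: has_odd_subgraph_def)
    then show ?thesis
      using card_induced_edges_insert2[OF G W(3) uv(3-5)] by (cases "{u, v} \<in> E") simp_all
  qed
  show ?thesis
    using par[of a c] par[of b c] par[of a d] par[of b d]
    by (simp only: insert_iff even_add simp_thms) argo
qed

text \<open>
  The colour of \<open>v\<close> is its adjacency to a base vertex \<open>z\<close>, and \<open>s\<close> is the common parity of the
  triangles through \<open>z\<close>. Giving \<open>z\<close> itself the colour \<open>s\<close> makes the formula hold at \<open>z\<close> too.
\<close>

lemma two_coloured_if_even_four_cycles: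
  assumes "card V \<ge> 3"
    and cyc: "\<And>a b c d. \<lbrakk>a \<in> V; b \<in> V; c \<in> V; d \<in> V; distinct [a, b, c, d]\<rbrakk> \<Longrightarrow>
      ({a, c} \<in> E \<longleftrightarrow> {b, c} \<in> E) \<longleftrightarrow> ({a, d} \<in> E \<longleftrightarrow> {b, d} \<in> E)"
  shows "\<exists>P s. two_coloured V E P s"
proof -
  obtain T where "T \<subseteq> V" "card T = 3"
    using assms(1) by (meson obtain_subset_with_card_n)
  then obtain z p q where zpq: "z \<in> V" "p \<in> V" "q \<in> V" "z \<noteq> p" "z \<noteq> q" "p \<noteq> q"
    by (auto simp: card_3_iff)
  \<comment> \<open>the triangle \<open>z u v\<close> has an odd number of edges\<close>
  define tri where "tri u v \<longleftrightarrow> ({u, v} \<in> E) = ({z, u} \<in> E \<longleftrightarrow> {z, v} \<in> E)" for u v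
  have tri_sym: "tri u v = tri v u" for u v
    by (auto simp: tri_def insert_commute)
  have tri_step: "tri u v = tri u w"
    if "u \<in> V - {z}" "v \<in> V - {z}" "w \<in> V - {z}" "u \<noteq> v" "u \<noteq> w" for u v w
    using cyc[of u z v w] that zpq(1) by (cases "v = w") (auto simp: tri_def)
  have tri: "tri u v = tri p q" if uv: "u \<in> V - {z}" "v \<in> V - {z}" "u \<noteq> v" for u v
  proof (cases "u = p")
    case True
    then show ?thesis using tri_step[of p v q] uv zpq by auto
  next
    case False
    then have "tri u v = tri p u" using tri_step[of u v p] tri_sym uv zpq by auto
    then show ?thesis using tri_step[of p u q] uv zpq False by auto
  qed
  define s where "s \<longleftrightarrow> tri p q"
  define P where "P v \<longleftrightarrow> (if v = z then s else {z, v} \<in> E)" for v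
  have "{u, v} \<in> E \<longleftrightarrow> (P u \<noteq> P v) \<noteq> s" if "u \<in> V" "v \<in> V" "u \<noteq> v" for u v
  proof (cases "u = z \<or> v = z")
    case True
    then show ?thesis using that by (auto simp: P_def insert_commute)
  next
    case False
    then have "tri u v = s" using tri[of u v] that by (simp add: s_def)
    then show ?thesis using False by (simp add: P_def tri_def) argo
  qed
  then show ?thesis by (auto simp: two_coloured_def)
qed

lemma two_coloured_if_no_odd_subgraph:
  assumes "simple_graph V E" "k \<ge> 2" "card V \<ge> k + 2" "\<not> has_odd_subgraph k V E"
  obtains P s where "two_coloured V E P s"
proof -
  have "card V \<ge> 3" using assms(2,3) by simp
  then show ?thesis
    using two_coloured_if_even_four_cycles[of V E] even_four_cycle[OF assms] that by blast
qed

section \<open>The classification\<close>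

lemma even_choose_two_iff:
  assumes "odd k"
  shows "even (k choose 2) \<longleftrightarrow> k mod 4 = 1"
proof -
  obtain m where "k = 2 * m + 1" using assms by (rule oddE)
  then have "k choose 2 = (2 * m + 1) * m" "k mod 4 = 1 \<longleftrightarrow> even m"
    by (simp_all add: choose_two) presburger
  then show ?thesis by simp
qed

lemma no_odd_subgraph_iff:
  assumes k: "k \<ge> 2" and G: "simple_graph V E" and large: "card V \<ge> 2 * k"
  shows "\<not> has_odd_subgraph k V E \<longleftrightarrow>
      E = {}
    \<or> (odd k \<and> complete_bipartite V E)
    \<or> (even (k choose 2) \<and> clique V E)
    \<or> (k mod 4 = 1 \<and> disjoint_union_two_cliques V E)" (is "_ \<longleftrightarrow> ?R")
proof
  have k1: "k \<ge> 1" using k by simp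
  note iff = no_odd_subgraph_iff_two_coloured[OF G _ k1 large]
  {
    assume no: "\<not> has_odd_subgraph k V E"
    then obtain P s where col: "two_coloured V E P s"
      using two_coloured_if_no_odd_subgraph[OF G k] k large by auto
    note arith = iff[OF col, THEN iffD1, OF no]
    show ?R
    proof (cases "{v \<in> V. P v} = {} \<or> {v \<in> V. \<not> P v} = {}")
      case single: True
      show ?thesis
      proof (cases s)
        case False
        then have "E = {}" using edgeless_if_two_coloured[OF G _ single] col by simp
        then show ?thesis by simp
      next
        case True
        then have "clique V E" using clique_if_two_coloured[OF _ single] col by simp
        then show ?thesis using arith True by simp
      qed
    next
      case False
      then have ne: "{v \<in> V. P v} \<noteq> {}" "{v \<in> V. \<not> P v} \<noteq> {}" by simp_all
      then have "odd k" using arith by blast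
      show ?thesis
      proof (cases s)
        case False
        then have "complete_bipartite V E"
          using complete_bipartite_if_two_coloured[OF G _ ne] col by simp
        then show ?thesis using \<open>odd k\<close> by simp
      next
        case True
        then have "disjoint_union_two_cliques V E"
          using disjoint_union_two_cliques_if_two_coloured[OF _ ne] col by simp
        moreover have "k mod 4 = 1" using arith True even_choose_two_iff[OF \<open>odd k\<close>] by simp
        ultimately show ?thesis by simp
      qed
    qed
  next
    assume ?R
    then consider "E = {}" | "odd k" "complete_bipartite V E"
      | "even (k choose 2)" "clique V E" | "k mod 4 = 1" "disjoint_union_two_cliques V E"
      by blast
    then show "\<not> has_odd_subgraph k V E"
    proof cases
      case 1
      then have "two_coloured V E (\<lambda>_. True) False" by (simp add: two_coloured_def)
      from iff[OF this] show ?thesis by simp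
    next
      case 2
      then obtain P where "two_coloured V E P False"
        using two_coloured_if_complete_bipartite by blast
      from iff[OF this] show ?thesis using 2 by simp
    next
      case 3
      then have "two_coloured V E (\<lambda>_. True) True" by (simp add: two_coloured_def clique_def)
      from iff[OF this] show ?thesis using 3 by simp
    next
      case 4
      then obtain P where "two_coloured V E P True"
        using two_coloured_if_disjoint_union_two_cliques by blast
      moreover have "odd k" using 4(1) by presburger
      moreover have "even (k choose 2)" using even_choose_two_iff 4(1) \<open>odd k\<close> by blast
      ultimately show ?thesis using iff by blast
    qed
  }
qed

theorem corollary3p8:
  fixes k :: nat and V :: "'a set" and E :: "'a set set"
  assumes "k \<ge> 2"
    and "simple_graph V E"
    and "card V \<ge> 2 ^ (2 * k)"
  shows "\<not> has_odd_subgraph k V E \<longleftrightarrow>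
      E = {}
    \<or> (odd k \<and> complete_bipartite V E)
    \<or> (even (k choose 2) \<and> clique V E)
    \<or> (k mod 4 = 1 \<and> disjoint_union_two_cliques V E)"
proof -
  have "2 * k \<le> card V" using assms(3) less_exp[of "2 * k"] by linarith
  with assms(1,2) show ?thesis by (rule no_odd_subgraph_iff)
qed

end
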